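(* For $n\ge 1$ let $N(n)$ be the Nimber of the game Cycles with Sources played on the line segment with $n$ edges, all edges being initially unmarked. Then $(N(1),N(2),\dots,N(18))$ is $$0,1,0,1,0,3,2,0,2,3,0,1,0,1,0,5,7,0,$$ and from $n=19$ on the values repeat with period $17$ the sequence $$1,0,1,0,3,2,4,5,3,0,1,0,1,0,5,7,8.$$ That is, if $(c_0,\dots,c_{16})$ denotes this last sequence, then $N(n)=c_{(n-19)\bmod 17}$ for all $n\ge 19$.
   Context: The line segment with $n$ edges is the path graph with $n+1$ vertices $v_0,\dots,v_n$ and edges $v_{j-1}v_j$, $1\le j\le n$. Cycles with Sources is the following two-player impartial game on a graph. Initially all edges are unmarked. The players alternate; a move consists of choosing an unmarked edge and marking it with an arrow in one of its two directions, subject to the rule that no move may create a sink. A sink is a vertex all of whose incident edges are marked and directed toward it (in particular, an endpoint of the path, which has only one incident edge, becomes a sink if that edge is directed toward it). Creating sources (vertices all of whose incident edges are marked and directed away from them) is allowed. On a path, a player with no legal move loses. The Nimber (Sprague–Grundy value) of a position is the mex (minimum excluded non-negative integer) of the Nimbers of all positions reachable in one move. *)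

theory Defs
  imports Main
begin

definition mex :: "nat set \<Rightarrow> nat" where
  "mex S = (LEAST k. k \<notin> S)"

text \<open>
  Sprague--Grundy values for an impartial game given by its option map, defined by well-founded
  recursion along moves. The value is meaningful when the move relation is well-founded, in which
  case the usual recursion equation \<open>nimber_rec\<close> holds.
\<close>

definition move_rel :: "('p \<Rightarrow> 'p set) \<Rightarrow> ('p \<times> 'p) set" where
  "move_rel opts = {(q, p). q \<in> opts p}"

definition nimber :: "('p \<Rightarrow> 'p set) \<Rightarrow> 'p \<Rightarrow> nat" where
  "nimber opts = wfrec (move_rel opts) (\<lambda>f p. mex (f ` opts p))"

lemma nimber_rec:
  assumes "wf (move_rel opts)"
  shows "nimber opts p = mex (nimber opts ` opts p)"
proof -
  have "nimber opts p = mex (cut (nimber opts) (move_rel opts) p ` opts p)"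
    unfolding nimber_def by (rule wfrec[OF assms])
  also have "cut (nimber opts) (move_rel opts) p ` opts p = nimber opts ` opts p"
    by (rule image_cong) (auto simp: cut_apply move_rel_def)
  finally show ?thesis .
qed

text \<open>
  A graph is given by its set \<open>E\<close> of edges, each a two-element set of vertices, so there are no
  isolated vertices. A position is the set \<open>D\<close> of arrows drawn so far; \<open>(u, v) \<in> D\<close> means that
  the edge \<open>{u, v}\<close> is marked with an arrow from \<open>u\<close> to \<open>v\<close>.
\<close>

definition marked :: "('v \<times> 'v) set \<Rightarrow> 'v \<Rightarrow> 'v \<Rightarrow> bool" where
  "marked D u v \<longleftrightarrow> (u, v) \<in> D \<or> (v, u) \<in> D"

definition sink :: "'v set set \<Rightarrow> ('v \<times> 'v) set \<Rightarrow> 'v \<Rightarrow> bool" where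
  "sink E D v \<longleftrightarrow> v \<in> \<Union>E \<and> (\<forall>u. {u, v} \<in> E \<longrightarrow> (u, v) \<in> D)"

text \<open>
  On boards containing cycles the game also has rules about completed cycles; they are vacuous on
  a path and not modelled. A position without options is lost for the player to move.
\<close>

definition cws_moves :: "'v set set \<Rightarrow> ('v \<times> 'v) set \<Rightarrow> ('v \<times> 'v) set set" where
  "cws_moves E D = {insert (u, v) D | u v.
     {u, v} \<in> E \<and> \<not> marked D u v \<and>
     \<not> (\<exists>w. \<not> sink E D w \<and> sink E (insert (u, v) D) w)}"

lemma wf_cws_moves:
  assumes "finite E"
  shows "wf (move_rel (cws_moves E))"
proof -
  define unm where "unm D = {e \<in> E. \<not> (\<exists>u v. e = {u, v} \<and> (u, v) \<in> D)}" for D :: "('a \<times> 'a) set"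
  have fin: "finite (unm D)" for D
    using assms by (simp add: unm_def)
  have "(D', D) \<in> measure (\<lambda>D. card (unm D))" if mv: "D' \<in> cws_moves E D" for D D'
  proof -
    obtain u v where uv: "D' = insert (u, v) D" "{u, v} \<in> E" "\<not> marked D u v"
      using mv by (auto simp: cws_moves_def)
    have "unm D' \<subseteq> unm D"
      unfolding unm_def uv(1) by blast
    moreover have "{u, v} \<in> unm D"
      using uv(2,3) by (auto simp: unm_def marked_def doubleton_eq_iff)
    moreover have "{u, v} \<notin> unm D'"
      unfolding unm_def uv(1) by blast
    ultimately have "unm D' \<subset> unm D"
      by blast
    then show ?thesis
      by (simp add: psubset_card_mono[OF fin])
  qed
  then have "move_rel (cws_moves E) \<subseteq> measure (\<lambda>D. card (unm D))"
    by (auto simp: move_rel_def)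
  then show ?thesis
    by (rule wf_subset[OF wf_measure])
qed

definition path_edges :: "nat \<Rightarrow> nat set set" where
  "path_edges n = {{j - 1, j} | j. 1 \<le> j \<and> j \<le> n}"

lemma finite_path_edges: "finite (path_edges n)"
  by (simp add: path_edges_def)

definition path_nimber :: "nat \<Rightarrow> nat" where
  "path_nimber n = nimber (cws_moves (path_edges n)) {}"

lemmas path_game_rec = nimber_rec[OF wf_cws_moves[OF finite_path_edges]]

end

theory Submission
  imports Defs
begin

text \<open>
  Append to the path a marked edge at each end, both pointing inwards. The only remaining rule is then
  that a right arrow is never directly followed by a left arrow, and a marked edge separates the
  two sides completely. Hence a position is the disjunctive sum of its maximal unmarked segments,
  whose Nimbers depend only on their length and on the two bounding arrows. This gives recurrences
  of the same shape as for octal games, so, as in the Guy--Smith theorem, eventual periodicity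
  follows once it is verified for sufficiently many initial values.
\<close>

unbundle bit_operations_syntax

section \<open>Minimum excluded values and the XOR rule for sums of games\<close>

lemma mex_eqI:
  assumes "v \<notin> S" "\<And>u. u < v \<Longrightarrow> u \<in> S"
  shows "mex S = v"
  unfolding mex_def using assms by (intro Least_equality) (auto simp: not_less[symmetric])

lemma mex_notin:
  assumes "finite S"
  shows "mex S \<notin> S"
proof -
  have "\<exists>k. k \<notin> S"
    using assms ex_new_if_finite infinite_UNIV_nat by blast
  then show ?thesis
    unfolding mex_def by (rule LeastI_ex)
qed

lemma less_mex_mem: "u < mex S \<Longrightarrow> u \<in> S"
  unfolding mex_def using not_less_Least by blast

lemma xor_nat_cancel:
  fixes a b :: nat
  shows "(a XOR b) XOR b = a" "a XOR (a XOR b) = b"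
  by (simp add: xor.assoc, simp flip: xor.assoc)

text \<open>At the highest bit where \<open>w\<close> and \<open>a XOR b\<close> differ, exactly one
  of \<open>a\<close> and \<open>b\<close> has a 1, and the change that turns the XOR into
  \<open>w\<close> lowers that number. The induction halves all numbers until this bit is the
  last.\<close>

lemma less_xor_cases:
  fixes a b w :: nat
  assumes "w < a XOR b"
  shows "w XOR b < a \<or> a XOR w < b"
  using assms
proof (induction w arbitrary: a b rule: less_induct)
  case (less w)
  have r: "x XOR y = of_bool (odd x \<noteq> odd y) + 2 * ((x div 2) XOR (y div 2))" for x y :: nat
    by (rule xor_rec)
  consider "w div 2 < (a div 2) XOR (b div 2)"
    | "w div 2 = (a div 2) XOR (b div 2)" "even w" "odd a \<noteq> odd b"
  proof -
    define x where "x = (a div 2) XOR (b div 2)"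
    have "w < of_bool (odd a \<noteq> odd b) + 2 * x"
      using less.prems r[of a b] unfolding x_def by simp
    then have "w div 2 < x \<or> w div 2 = x \<and> even w \<and> (odd a \<noteq> odd b)"
      by (cases "odd a \<noteq> odd b") (simp_all, presburger+)
    then show ?thesis
      using that unfolding x_def by blast
  qed
  then show ?case
  proof cases
    case 1
    have "(w div 2) XOR (b div 2) < a div 2 \<or> (a div 2) XOR (w div 2) < b div 2"
    \<comment> \<open>\<open>w div 2 < w\<close> fails only for \<open>w = 0\<close>; there the
      halves of \<open>a\<close> and \<open>b\<close> differ, so one is smaller than the
      other.\<close>
    proof (cases "w = 0")
      case True
      then show ?thesis using 1
        by (cases "a div 2" "b div 2" rule: linorder_cases) simp_all
    next
      case False
      then show ?thesis using less.IH[of "w div 2"] 1 by simp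
    qed
    moreover have "x XOR y < z" if "(x div 2) XOR (y div 2) < z div 2" for x y z :: nat
    proof -
      have "x XOR y \<le> 1 + 2 * ((x div 2) XOR (y div 2))"
        by (rule ord_eq_le_trans[OF r]) simp
      with that show ?thesis by linarith
    qed
    ultimately show ?thesis by blast
  next
    case 2
    \<comment> \<open>The differing bit is the last one: clearing the last bit of the odd one of
      \<open>a\<close> and \<open>b\<close> gives the required smaller number.\<close>
    have wb: "(w div 2) XOR (b div 2) = a div 2" and wa: "(a div 2) XOR (w div 2) = b div 2"
      by (simp_all add: 2(1) xor_nat_cancel)
    show ?thesis
      using 2(2,3) r[of w b] r[of a w] unfolding wa wb
      by (cases "odd a") (auto elim!: oddE evenE)
  qed
qed

text \<open>This is the Sprague-Grundy rule for a sum, with \<open>A\<close> and \<open>B\<close>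
  the Nimbers of the options of the summands. Cancellation keeps the value itself out of the set,
  and \<open>less_xor_cases\<close> reaches each smaller value.\<close>

lemma mex_xor:
  assumes "finite A" "finite B"
  shows "mex A XOR mex B = mex ((\<lambda>a. a XOR mex B) ` A \<union> (\<lambda>b. mex A XOR b) ` B)"
proof (rule mex_eqI[symmetric])
  have "mex A XOR mex B \<noteq> a XOR mex B" if "a \<in> A" for a
    using that mex_notin[OF assms(1)] xor_nat_cancel(1) by metis
  moreover have "mex A XOR mex B \<noteq> mex A XOR b" if "b \<in> B" for b
    using that mex_notin[OF assms(2)] xor_nat_cancel(2) by metis
  ultimately show "mex A XOR mex B \<notin> (\<lambda>a. a XOR mex B) ` A \<union> (\<lambda>b. mex A XOR b) ` B"
    by blast
next
  fix w assume "w < mex A XOR mex B"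
  then consider "w XOR mex B \<in> A" | "mex A XOR w \<in> B"
    using less_xor_cases less_mex_mem by blast
  then show "w \<in> (\<lambda>a. a XOR mex B) ` A \<union> (\<lambda>b. mex A XOR b) ` B"
  proof cases
    case 1
    then show ?thesis
      by (intro UnI1 rev_image_eqI[OF 1]) (simp add: xor_nat_cancel)
  next
    case 2
    then show ?thesis
      by (intro UnI2 rev_image_eqI[OF 2]) (simp add: xor_nat_cancel)
  qed
qed

text \<open>If \<open>f\<close> maps options onto options, both recursions take the mex of the same
  values. The invariant \<open>P\<close>, closed under moves, limits this demand to the positions of
  interest.\<close>

lemma nimber_image:
  assumes wf: "wf (move_rel opts)" and wf': "wf (move_rel opts')"
    and inv: "\<And>p q. P p \<Longrightarrow> q \<in> opts p \<Longrightarrow> P q"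
    and opts: "\<And>p. P p \<Longrightarrow> opts' (f p) = f ` opts p"
    and "P p"
  shows "nimber opts' (f p) = nimber opts p"
  using wf \<open>P p\<close>
proof (induction p rule: wf_induct_rule)
  case (less p)
  have "nimber opts' (f p) = mex (nimber opts' ` f ` opts p)"
    by (subst nimber_rec[OF wf']) (simp only: opts[OF less.prems])
  also have "nimber opts' ` f ` opts p = nimber opts ` opts p"
    unfolding image_image using less inv by (intro image_cong) (auto simp: move_rel_def)
  finally show ?case
    by (simp only: nimber_rec[OF wf, of p])
qed

section \<open>Marking moves on rows of edges\<close>

text \<open>
  Rows of edges as lists: \<open>Some True\<close> is a right arrow, \<open>Some False\<close> a left arrow, \<open>None\<close> an
  unmarked edge.
\<close>

definition no_sink :: "bool option list \<Rightarrow> bool" where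
  "no_sink = successively (\<lambda>x y. \<not> (x = Some True \<and> y = Some False))"

text \<open>Requiring the whole new row to be free of sinks agrees with the rule against creating
  one as long as the old row has none.\<close>

definition list_moves :: "bool option list \<Rightarrow> bool option list set" where
  "list_moves zs = {us @ Some d # vs | us d vs. zs = us @ None # vs \<and> no_sink (us @ Some d # vs)}"

lemma list_movesI: "no_sink (us @ Some d # vs) \<Longrightarrow> us @ Some d # vs \<in> list_moves (us @ None # vs)"
  by (auto simp: list_moves_def)

lemma list_movesE:
  assumes "z \<in> list_moves zs"
  obtains us d vs where "z = us @ Some d # vs" "zs = us @ None # vs" "no_sink z"
  using assms by (auto simp: list_moves_def)

lemma no_sink_append_Cons:
  "no_sink (xs @ Some d # ys) \<longleftrightarrow> no_sink (xs @ [Some d]) \<and> no_sink (Some d # ys)"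
  by (auto simp: no_sink_def successively_append_iff successively_Cons)

lemma no_sink_nth:
  "no_sink zs \<longleftrightarrow> (\<forall>i. Suc i < length zs \<longrightarrow> \<not> (zs ! i = Some True \<and> zs ! Suc i = Some False))"
proof (induction zs)
  case (Cons z zs)
  then show ?case
    by (cases zs) (auto simp: no_sink_def nth_Cons split: nat.splits)
qed (simp add: no_sink_def)

lemma list_moves_nth:
  "list_moves zs = {zs[i := Some d] | i d. i < length zs \<and> zs ! i = None \<and> no_sink (zs[i := Some d])}"
proof (intro equalityI subsetI)
  fix z assume "z \<in> list_moves zs"
  then obtain us d vs where "z = us @ Some d # vs" "zs = us @ None # vs" "no_sink z"
    by (auto simp: list_moves_def)
  then show "z \<in> {zs[i := Some d] | i d. i < length zs \<and> zs ! i = None \<and> no_sink (zs[i := Some d])}"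
    by (auto intro!: exI[of _ "length us"] exI[of _ d])
next
  fix z assume "z \<in> {zs[i := Some d] | i d. i < length zs \<and> zs ! i = None \<and> no_sink (zs[i := Some d])}"
  then obtain i d where i: "z = zs[i := Some d]" "i < length zs" "zs ! i = None" "no_sink z"
    by auto
  have "z = take i zs @ Some d # drop (Suc i) zs"
    using i(1,2) by (simp add: upd_conv_take_nth_drop)
  moreover have "zs = take i zs @ None # drop (Suc i) zs"
    using id_take_nth_drop[OF i(2)] i(3) by simp
  ultimately show "z \<in> list_moves zs"
    using i(4) unfolding list_moves_def by blast
qed

lemma finite_list_moves: "finite (list_moves zs)"
proof (rule finite_subset)
  show "list_moves zs \<subseteq> {xs. set xs \<subseteq> UNIV \<and> length xs = length zs}"
    by (auto simp: list_moves_def)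
qed (rule finite_lists_length_eq, simp)

lemma wf_list_moves: "wf (move_rel list_moves)"
  by (rule wf_subset[OF wf_measure[of "\<lambda>zs. count_list zs None"]])
    (auto simp: move_rel_def list_moves_def)

abbreviation list_nimber :: "bool option list \<Rightarrow> nat" where
  "list_nimber \<equiv> nimber list_moves"

lemmas list_nimber_rec = nimber_rec[OF wf_list_moves]

section \<open>Splitting a position at a marked edge\<close>

text \<open>Only adjacent entries can clash, so legality on one side of a marked edge involves just
  that side and the edge itself. Each side therefore keeps a copy of \<open>Some d\<close>.\<close>

lemma list_moves_append_Cons:
  assumes "no_sink (xs @ Some d # ys)"
  shows "list_moves (xs @ Some d # ys) =
    {xs' @ Some d # ys | xs'. xs' @ [Some d] \<in> list_moves (xs @ [Some d])} \<union>
    {xs @ Some d # ys' | ys'. Some d # ys' \<in> list_moves (Some d # ys)}"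
    (is "?L = ?A \<union> ?B")
proof (intro equalityI subsetI)
  fix z assume "z \<in> ?L"
  then obtain us f vs where z: "z = us @ Some f # vs" "xs @ Some d # ys = us @ None # vs" "no_sink z"
    by (auto simp: list_moves_def)
  \<comment> \<open>The newly marked entry was \<open>None\<close>, hence lies strictly to the left
    or right of \<open>Some d\<close>.\<close>
  from z(2) consider ws where "xs = us @ None # ws" "vs = ws @ Some d # ys"
    | ws where "us = xs @ Some d # ws" "ys = ws @ None # vs"
    by (auto simp: append_eq_append_conv2 Cons_eq_append_conv append_eq_Cons_conv)
  then show "z \<in> ?A \<union> ?B"
  proof cases
    case 1
    then have "us @ Some f # ws @ [Some d] \<in> list_moves (xs @ [Some d])"
      using z(3) no_sink_append_Cons[of "us @ Some f # ws" d ys] unfolding z(1)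
      using list_movesI[of us f "ws @ [Some d]"] by simp
    then show ?thesis
      unfolding z(1) 1 by (auto intro!: disjI1 exI[of _ "us @ Some f # ws"])
  next
    case 2
    then have "Some d # ws @ Some f # vs \<in> list_moves (Some d # ys)"
      using z(3) no_sink_append_Cons[of xs d "ws @ Some f # vs"] unfolding z(1)
      using list_movesI[of "Some d # ws" f vs] by simp
    then show ?thesis
      unfolding z(1) 2 by auto
  qed
next
  fix z assume "z \<in> ?A \<union> ?B"
  then show "z \<in> ?L"
  proof
    assume "z \<in> ?A"
    then obtain xs' us f vs where z: "z = xs' @ Some d # ys" "xs' @ [Some d] = us @ Some f # vs"
      "xs @ [Some d] = us @ None # vs" "no_sink (us @ Some f # vs)"
      unfolding list_moves_def by blast
    from z(3) obtain ws where ws: "vs = ws @ [Some d]" "xs = us @ None # ws"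
      by (cases vs rule: rev_cases) auto
    then have "xs' = us @ Some f # ws"
      using z(2) by simp
    then show "z \<in> ?L"
      using z(1,4) ws assms no_sink_append_Cons[of xs' d ys] no_sink_append_Cons[of xs d ys]
        list_movesI[of us f "ws @ Some d # ys"] by simp
  next
    assume "z \<in> ?B"
    then obtain ys' us f vs where z: "z = xs @ Some d # ys'" "Some d # ys' = us @ Some f # vs"
      "Some d # ys = us @ None # vs" "no_sink (us @ Some f # vs)"
      unfolding list_moves_def by blast
    from z(3) obtain ws where ws: "us = Some d # ws" "ys = ws @ None # vs"
      by (cases us) auto
    then have "ys' = ws @ Some f # vs"
      using z(2) by simp
    then show "z \<in> ?L"
      using z(1,4) ws assms no_sink_append_Cons[of xs d ys'] no_sink_append_Cons[of xs d ys]
        list_movesI[of "xs @ us" f vs] by simp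
  qed
qed

text \<open>The two sides are independent games, so their Nimbers combine by \<open>mex_xor\<close>.
  The induction is on the number of unmarked edges, of which every move uses up one.\<close>

lemma list_nimber_append_Cons:
  assumes "no_sink (xs @ Some d # ys)"
  shows "list_nimber (xs @ Some d # ys) = list_nimber (xs @ [Some d]) XOR list_nimber (Some d # ys)"
  using assms
proof (induction "count_list (xs @ ys) None" arbitrary: xs ys rule: less_induct)
  case less
  let ?x = "xs @ [Some d]" and ?y = "Some d # ys"
  \<comment> \<open>A move on the left part cannot touch its final arrow, so the result can be
    rejoined with \<open>ys\<close> and the induction hypothesis applies.\<close>
  have L: "\<exists>xs'. z = xs' @ [Some d] \<and> no_sink (xs' @ Some d # ys) \<and>
      count_list xs' None < count_list xs None" if m: "z \<in> list_moves ?x" for z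
  proof -
    obtain us f vs where z: "z = us @ Some f # vs" "?x = us @ None # vs" "no_sink z"
      using m by (rule list_movesE)
    from z(2) obtain ws where ws: "vs = ws @ [Some d]" "xs = us @ None # ws"
      by (cases vs rule: rev_cases) auto
    then have "z = (us @ Some f # ws) @ [Some d]"
      using z(1) by simp
    moreover have "no_sink ((us @ Some f # ws) @ Some d # ys)"
      using z(3) less.prems calculation
        no_sink_append_Cons[of xs d ys] no_sink_append_Cons[of "us @ Some f # ws" d ys] by simp
    ultimately show ?thesis
      using ws(2) by (intro exI[of _ "us @ Some f # ws"]) simp
  qed
  have R: "\<exists>ys'. z = Some d # ys' \<and> no_sink (xs @ Some d # ys') \<and>
      count_list ys' None < count_list ys None" if m: "z \<in> list_moves ?y" for z
  proof -
    obtain us f vs where z: "z = us @ Some f # vs" "?y = us @ None # vs" "no_sink z"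
      using m by (rule list_movesE)
    from z(2) obtain ws where ws: "us = Some d # ws" "ys = ws @ None # vs"
      by (cases us) auto
    then have "z = Some d # ws @ Some f # vs"
      using z(1) by simp
    moreover have "no_sink (xs @ Some d # ws @ Some f # vs)"
      using z(3) less.prems calculation
        no_sink_append_Cons[of xs d ys] no_sink_append_Cons[of xs d "ws @ Some f # vs"] by simp
    ultimately show ?thesis
      using ws(2) by (intro exI[of _ "ws @ Some f # vs"]) simp
  qed
  have 1: "list_nimber ` {xs' @ Some d # ys | xs'. xs' @ [Some d] \<in> list_moves ?x} =
      (\<lambda>a. a XOR list_nimber ?y) ` list_nimber ` list_moves ?x" (is "_ ` ?A = _")
  proof -
    have "?A = (\<lambda>z. z @ ys) ` list_moves ?x"
    proof (intro equalityI subsetI)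
      fix z assume "z \<in> ?A"
      then obtain xs' where "z = xs' @ Some d # ys" "xs' @ [Some d] \<in> list_moves ?x"
        by blast
      then show "z \<in> (\<lambda>z. z @ ys) ` list_moves ?x"
        by (intro rev_image_eqI[of "xs' @ [Some d]"]) simp_all
    next
      fix z assume "z \<in> (\<lambda>z. z @ ys) ` list_moves ?x"
      then obtain z' where z': "z = z' @ ys" "z' \<in> list_moves ?x"
        by blast
      then obtain xs' where "z' = xs' @ [Some d]"
        using L by blast
      with z' show "z \<in> ?A"
        by auto
    qed
    moreover have "list_nimber (z @ ys) = list_nimber z XOR list_nimber ?y"
      if "z \<in> list_moves ?x" for z
      using L[OF that] less.hyps[of _ ys] by auto
    ultimately show ?thesis
      by (simp add: image_image)
  qed
  have 2: "list_nimber ` {xs @ Some d # ys' | ys'. Some d # ys' \<in> list_moves ?y} =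
      (\<lambda>b. list_nimber ?x XOR b) ` list_nimber ` list_moves ?y" (is "_ ` ?B = _")
  proof -
    have "?B = (@) xs ` list_moves ?y"
      using R by blast
    moreover have "list_nimber (xs @ z) = list_nimber ?x XOR list_nimber z"
      if "z \<in> list_moves ?y" for z
      using R[OF that] less.hyps[of xs] by auto
    ultimately show ?thesis
      by (simp add: image_image)
  qed
  have "list_nimber (xs @ Some d # ys) =
      mex ((\<lambda>a. a XOR list_nimber ?y) ` list_nimber ` list_moves ?x \<union>
           (\<lambda>b. list_nimber ?x XOR b) ` list_nimber ` list_moves ?y)"
    by (subst list_nimber_rec, subst list_moves_append_Cons[OF less.prems])
      (simp only: image_Un 1 2)
  also have "\<dots> = list_nimber ?x XOR list_nimber ?y"
    unfolding list_nimber_rec[of ?x] list_nimber_rec[of ?y]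
    by (rule mex_xor[symmetric]) (simp_all add: finite_list_moves)
  finally show ?case .
qed

section \<open>Recurrence for unmarked segments between two arrows\<close>

definition board :: "bool \<Rightarrow> nat \<Rightarrow> bool \<Rightarrow> bool option list" where
  "board d k e = Some d # replicate k None @ [Some e]"

abbreviation immediate_sink :: "bool \<Rightarrow> nat \<Rightarrow> bool \<Rightarrow> bool" where
  "immediate_sink d k e \<equiv> d \<and> k = 0 \<and> \<not> e"

text \<open>Placing an arrow \<open>f\<close> leaves parts of lengths \<open>i\<close> and
  \<open>j\<close>; the \<open>Suc\<close> counts the edge just marked. The parameter
  \<open>g\<close> lets one recurrence serve both the actual Nimbers and the tabulated
  values.\<close>

definition segment_splits :: "(bool \<Rightarrow> nat \<Rightarrow> bool \<Rightarrow> nat) \<Rightarrow> bool \<Rightarrow> nat \<Rightarrow> bool \<Rightarrow> nat set" where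
  "segment_splits g d k e = {g d i f XOR g f j e | i j f.
     Suc (i + j) = k \<and> \<not> immediate_sink d i f \<and> \<not> immediate_sink f j e}"

lemma no_sink_board: "no_sink (board d k e) \<longleftrightarrow> \<not> immediate_sink d k e"
  by (cases k) (auto simp: no_sink_nth board_def nth_append nth_Cons split: nat.splits)

text \<open>Every move puts some arrow \<open>f\<close> inside the board, and the resulting row is
  the sum of two shorter boards that share \<open>f\<close>.\<close>

lemma list_nimber_board:
  "list_nimber (board d k e) = mex (segment_splits (\<lambda>d k e. list_nimber (board d k e)) d k e)"
proof -
  let ?join = "\<lambda>i f j. (Some d # replicate i None) @ Some f # (replicate j None @ [Some e])"
  have no_sink_join: "no_sink (?join i f j) \<longleftrightarrow> \<not> immediate_sink d i f \<and> \<not> immediate_sink f j e" for i f j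
    using no_sink_append_Cons[of "Some d # replicate i None" f "replicate j None @ [Some e]"]
      no_sink_board[of d i f] no_sink_board[of f j e] by (simp add: board_def)
  have nimber_join: "list_nimber (?join i f j) = list_nimber (board d i f) XOR list_nimber (board f j e)"
    if "\<not> immediate_sink d i f" "\<not> immediate_sink f j e" for i f j
    using list_nimber_append_Cons[of "Some d # replicate i None" f "replicate j None @ [Some e]"]
      no_sink_join that by (simp add: board_def)
  have moves: "list_moves (board d k e) =
    {?join i f j | i j f. Suc (i + j) = k \<and> \<not> immediate_sink d i f \<and> \<not> immediate_sink f j e}"
    (is "_ = ?M")
  proof (intro equalityI subsetI)
    fix z assume "z \<in> list_moves (board d k e)"
    then obtain us f vs where z: "z = us @ Some f # vs" "board d k e = us @ None # vs" "no_sink z"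
      by (rule list_movesE)
    obtain us' vs' where uv: "us = Some d # us'" "vs = vs' @ [Some e]"
      using z(2) unfolding board_def by (cases us; cases vs rule: rev_cases) auto
    then have eq: "replicate k None = us' @ None # vs'"
      using z(2) by (simp add: board_def)
    then have "us' = replicate (length us') None" "vs' = replicate (length vs') None"
      by (metis Un_iff in_set_replicate replicate_eqI set_append set_ConsD list.set_intros(2))+
    moreover have "Suc (length us' + length vs') = k"
      using arg_cong[OF eq, of length] by simp
    ultimately show "z \<in> ?M"
      using z(1,3) no_sink_join[of "length us'" f "length vs'"] uv by (intro CollectI exI conjI) auto
  next
    fix z assume "z \<in> ?M"
    then obtain i f j where z: "z = ?join i f j" "Suc (i + j) = k" "no_sink z"
      using no_sink_join by blast
    have "board d k e = (Some d # replicate i None) @ None # (replicate j None @ [Some e])"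
      unfolding board_def z(2)[symmetric] by (simp add: replicate_app_Cons_same flip: replicate_add)
    then show "z \<in> list_moves (board d k e)"
      using z(1,3) list_movesI by metis
  qed
  have "list_nimber ` list_moves (board d k e) = {list_nimber (?join i f j) | i j f.
      Suc (i + j) = k \<and> \<not> immediate_sink d i f \<and> \<not> immediate_sink f j e}"
    unfolding moves by blast
  also have "\<dots> = segment_splits (\<lambda>d k e. list_nimber (board d k e)) d k e"
    unfolding segment_splits_def
  proof (intro Collect_cong ex_cong1)
    fix x i j f
    show "(x = list_nimber (?join i f j) \<and> Suc (i + j) = k \<and> \<not> immediate_sink d i f \<and> \<not> immediate_sink f j e) \<longleftrightarrow>
      (x = list_nimber (board d i f) XOR list_nimber (board f j e) \<and>
       Suc (i + j) = k \<and> \<not> immediate_sink d i f \<and> \<not> immediate_sink f j e)"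
      using nimber_join[of i f j] by metis
  qed
  finally have "list_nimber ` list_moves (board d k e) =
    segment_splits (\<lambda>d k e. list_nimber (board d k e)) d k e" .
  then show ?thesis
    by (subst list_nimber_rec) simp
qed

section \<open>Tabulated values and their finite verification\<close>

text \<open>
  The rows are eventually periodic with period 17 and preperiod at most 27, found by computing
  with the recurrence above; only the values for lengths below \<open>44 = 27 + 17\<close> are listed.
  The segment of length 0 between \<open>True\<close> and \<open>False\<close> is itself a sink, so its value 0 is junk.
\<close>

fun value_table :: "bool \<Rightarrow> bool \<Rightarrow> nat list" where
  "value_table True False = [0,0,1,0,1,0,3,2,0,2,3,0,1,0,1,0,5,7,0,1,0,1,0,3,2,4,5,3,0,1,0,1,0,5,7,8,1,0,1,0,3,2,4,5]"
| "value_table False True = [0,1,0,1,0,3,2,0,2,3,0,1,0,1,0,5,7,0,1,0,1,0,3,2,4,5,3,0,1,0,1,0,5,7,8,1,0,1,0,3,2,4,5,3]"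
| "value_table _ _ = [0,1,2,3,1,3,2,4,5,2,3,1,3,2,1,4,2,4,1,2,3,1,3,2,4,5,2,3,1,3,2,1,4,3,4,1,2,3,1,3,2,4,5,9]"

definition segment_value :: "bool \<Rightarrow> nat \<Rightarrow> bool \<Rightarrow> nat" where
  "segment_value d k e = value_table d e ! (if k < 27 then k else 27 + (k - 27) mod 17)"

text \<open>
  The recurrence is checked on integers, whose binary representation makes \<open>XOR\<close> cheap. The bound
  88 is \<open>71 + 17\<close>: from length \<open>71 = 2 * 27 + 17\<close> on, adding 17 to the length amounts to adding 17
  to a part of length at least 27 in every split, so a further period brings nothing new.
  Below, \<open>a\<close> and \<open>b\<close> discard the split whose left or right part would be an immediate sink.
\<close>

definition value_list :: "bool \<Rightarrow> bool \<Rightarrow> int list" where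
  "value_list d e = (let t = map int (value_table d e); p = drop 27 t in t @ p @ p @ p)"

definition split_value_list :: "bool \<Rightarrow> nat \<Rightarrow> bool \<Rightarrow> int list" where
  "split_value_list d k e = concat (map (\<lambda>f.
     let a = (if d \<and> \<not> f then 1 else 0); b = (if f \<and> \<not> e then 1 else 0)
     in map2 (XOR) (drop a (value_list d f)) (drop a (rev (drop b (take k (value_list f e)))))) [True, False])"

definition check_value :: "nat \<Rightarrow> bool \<Rightarrow> bool \<Rightarrow> bool" where
  "check_value k d e = (let os = split_value_list d k e; v = value_list d e ! k in
     list_all (\<lambda>x. x \<noteq> v) os \<and> list_all (\<lambda>u. list_ex (\<lambda>x. x = int u) os) [0..<nat v])"

definition check_values :: "nat \<Rightarrow> nat \<Rightarrow> bool" where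
  "check_values m n = list_all (\<lambda>k. check_value k True True \<and> check_value k True False \<and>
     check_value k False True \<and> check_value k False False) [m..<n]"

lemma check_values_88: "check_values 0 88"
  by code_simp

lemma length_value_table: "length (value_table d e) = 44"
  by (cases "(d, e)" rule: value_table.cases) simp_all

lemma length_value_list: "length (value_list d e) = 95"
  by (simp add: value_list_def length_value_table Let_def)

lemma value_list_nth:
  assumes "k < 88"
  shows "value_list d e ! k = int (segment_value d k e)"
proof -
  \<comment> \<open>The periodic part of the table starts at 27; its three appended copies start at
    44, 61 and 78.\<close>
  consider "k < 27" | "27 \<le> k" "k < 44" | "44 \<le> k" "k < 61" | "61 \<le> k" "k < 78" | "78 \<le> k"
    by linarith
  then show ?thesis
    using assms
    by cases (auto simp: value_list_def segment_value_def length_value_table Let_def nth_append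
       mod_if[of "_ - 27" 17] mod_if[of "_ - 44" 17] mod_if[of "_ - 61" 17] mod_if[of "_ - 78" 17])
qed

text \<open>Reversing the first \<open>k\<close> entries of \<open>ys\<close> pairs index
  \<open>i\<close> with \<open>k - 1 - i\<close>. Dropping \<open>b\<close> entries before the
  reversal removes \<open>j < b\<close>; dropping \<open>a\<close> from both lists afterwards
  removes \<open>i < a\<close>.\<close>

lemma set_map2_rev:
  assumes "k \<le> length xs" "k \<le> length ys"
  shows "set (map2 h (drop a xs) (drop a (rev (drop b (take k ys))))) =
    {h (xs ! i) (ys ! j) | i j. Suc (i + j) = k \<and> a \<le> i \<and> b \<le> j}" (is "?L = ?R")
proof (intro equalityI subsetI)
  fix x assume "x \<in> ?L"
  then obtain t where t: "t < k - b - a" "x = h (xs ! (a + t)) (rev (drop b (take k ys)) ! (a + t))"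
    using assms by (auto simp: set_zip)
  then have "x = h (xs ! (a + t)) (ys ! (k - Suc (a + t)))"
    using assms by (simp add: rev_nth)
  then show "x \<in> ?R"
    using t(1) by (intro CollectI exI[of _ "a + t"] exI[of _ "k - Suc (a + t)"]) auto
next
  fix x assume "x \<in> ?R"
  then obtain i j where ij: "x = h (xs ! i) (ys ! j)" "Suc (i + j) = k" "a \<le> i" "b \<le> j"
    by blast
  then have "j = b + (k - b - Suc i)" "i < k - b"
    by auto
  then have "x = h (drop a xs ! (i - a)) (drop a (rev (drop b (take k ys))) ! (i - a))"
    using ij assms by (simp add: rev_nth)
  moreover have "i - a < length (drop a xs)" "i - a < length (drop a (rev (drop b (take k ys))))"
    using ij assms by auto
  ultimately show "x \<in> ?L"
    by (force simp: set_zip)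
qed

lemma set_split_value_list:
  assumes "k < 88"
  shows "set (split_value_list d k e) = int ` segment_splits segment_value d k e"
proof -
  have f: "set (let a = (if d \<and> \<not> f then 1 else 0); b = (if f \<and> \<not> e then 1 else 0)
     in map2 (XOR) (drop a (value_list d f)) (drop a (rev (drop b (take k (value_list f e)))))) =
    int ` {segment_value d i f XOR segment_value f j e | i j.
      Suc (i + j) = k \<and> \<not> immediate_sink d i f \<and> \<not> immediate_sink f j e}" (is "?L f = int ` ?R f") for f
  proof -
    have "?L f = {value_list d f ! i XOR value_list f e ! j | i j.
        Suc (i + j) = k \<and> (if d \<and> \<not> f then 1 else 0) \<le> i \<and> (if f \<and> \<not> e then 1 else 0) \<le> j}"
      unfolding Let_def using assms by (intro set_map2_rev) (simp_all add: length_value_list)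
    also have "\<dots> = {int (segment_value d i f XOR segment_value f j e) | i j.
        Suc (i + j) = k \<and> \<not> immediate_sink d i f \<and> \<not> immediate_sink f j e}"
    proof -
      have "value_list d f ! i XOR value_list f e ! j = int (segment_value d i f XOR segment_value f j e)"
        if "Suc (i + j) = k" for i j
        using that assms by (simp add: value_list_nth of_nat_xor_eq)
      \<comment> \<open>The drop counts 1 and 0 thus exclude an empty part precisely when it would
        be an immediate sink.\<close>
      moreover have "(if c then 1 else 0) \<le> i \<longleftrightarrow> \<not> (c \<and> i = 0)" for c and i :: nat
        by auto
      ultimately show ?thesis
        by (intro Collect_cong ex_cong1) auto
    qed
    finally show ?thesis
      by blast
  qed
  have "set (split_value_list d k e) = ?L True \<union> ?L False"
    unfolding split_value_list_def by (simp only: list.map concat.simps append_Nil2 set_append)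
  also have "\<dots> = int ` (?R True \<union> ?R False)"
    unfolding f image_Un ..
  also have "?R True \<union> ?R False = segment_splits segment_value d k e"
  proof (intro equalityI subsetI)
    fix x assume "x \<in> segment_splits segment_value d k e"
    then obtain i j f where "x \<in> ?R f"
      unfolding segment_splits_def by blast
    then show "x \<in> ?R True \<union> ?R False"
      by (cases f) simp_all
  qed (unfold segment_splits_def, blast)
  finally show ?thesis .
qed

lemma check_value_mex:
  assumes "check_value k d e" "k < 88"
  shows "mex (segment_splits segment_value d k e) = segment_value d k e"
proof (rule mex_eqI)
  show "segment_value d k e \<notin> segment_splits segment_value d k e"
    using assms set_split_value_list[OF assms(2), of d e]
    by (auto simp: check_value_def Let_def list_all_iff value_list_nth)
next
  fix u assume "u < segment_value d k e"
  then have "int u \<in> set (split_value_list d k e)"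
    using assms by (auto simp: check_value_def Let_def list_all_iff list_ex_iff value_list_nth)
  then show "u \<in> segment_splits segment_value d k e"
    unfolding set_split_value_list[OF assms(2)] by auto
qed

section \<open>Periodicity of the recurrence\<close>

lemma segment_value_periodic:
  assumes "27 \<le> k"
  shows "segment_value d (k + 17) e = segment_value d k e"
proof -
  have "k + 17 - 27 = k - 27 + 17"
    using assms by simp
  then show ?thesis
    using assms unfolding segment_value_def by (simp only: mod_add_self2) simp
qed

text \<open>A long split has a part in the periodic range. Shifting that part by 17 keeps its value,
  and it stays nonempty, so legality is unaffected.\<close>

lemma segment_splits_periodic:
  assumes "71 \<le> k"
  shows "segment_splits segment_value d (k + 17) e = segment_splits segment_value d k e"
    (is "?L = ?R")
proof (intro equalityI subsetI)
  fix x assume "x \<in> ?L"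
  then obtain i j f where x: "x = segment_value d i f XOR segment_value f j e" "Suc (i + j) = k + 17"
    "\<not> immediate_sink d i f" "\<not> immediate_sink f j e"
    unfolding segment_splits_def by blast
  then consider i' where "i = i' + 17" "27 \<le> i'" | j' where "j = j' + 17" "27 \<le> j'"
  proof -
    \<comment> \<open>Two parts below 44 would give \<open>i + j\<close> at most 86, yet it is at
      least 87. Taking 17 from a part of length at least 44 leaves at least 27.\<close>
    have "44 \<le> i \<or> 44 \<le> j"
      using x(2) assms by linarith
    then show ?thesis
      using that(1)[of "i - 17"] that(2)[of "j - 17"] by linarith
  qed
  then show "x \<in> ?R"
  proof cases
    case 1
    then have "x = segment_value d i' f XOR segment_value f j e" "Suc (i' + j) = k" "\<not> immediate_sink d i' f"
      using x segment_value_periodic by auto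
    with x(4) show ?thesis
      unfolding segment_splits_def by blast
  next
    case 2
    then have "x = segment_value d i f XOR segment_value f j' e" "Suc (i + j') = k" "\<not> immediate_sink f j' e"
      using x segment_value_periodic by auto
    with x(3) show ?thesis
      unfolding segment_splits_def by blast
  qed
next
  fix x assume "x \<in> ?R"
  then obtain i j f where x: "x = segment_value d i f XOR segment_value f j e" "Suc (i + j) = k"
    "\<not> immediate_sink d i f" "\<not> immediate_sink f j e"
    unfolding segment_splits_def by blast
  \<comment> \<open>Here \<open>i + j\<close> is at least 70, while two parts below 27 give at most
    52.\<close>
  then consider "27 \<le> i" | "27 \<le> j"
    using assms by linarith
  then show "x \<in> ?L"
  proof cases
    case 1
    then have "x = segment_value d (i + 17) f XOR segment_value f j e" "Suc (i + 17 + j) = k + 17"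
      "\<not> immediate_sink d (i + 17) f"
      using x segment_value_periodic by auto
    with x(4) show ?thesis
      unfolding segment_splits_def by blast
  next
    case 2
    then have "x = segment_value d i f XOR segment_value f (j + 17) e" "Suc (i + (j + 17)) = k + 17"
      "\<not> immediate_sink f (j + 17) e"
      using x segment_value_periodic by auto
    with x(3) show ?thesis
      unfolding segment_splits_def by blast
  qed
qed

text \<open>Lengths below 88 are covered by the computation; from 88 on, both sides are unchanged
  when 17 is subtracted, since at least 71 remains.\<close>

lemma mex_segment_splits: "mex (segment_splits segment_value d k e) = segment_value d k e"
proof (induction k rule: less_induct)
  case (less k)
  show ?case
  proof (cases "k < 88")
    case True
    then have "check_value k d e"
      using check_values_88 by (cases d; cases e) (auto simp: check_values_def list_all_iff)
    then show ?thesis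
      using check_value_mex True by blast
  next
    case False
    define m where "m = k - 17"
    have "k = m + 17" "71 \<le> m" "m < k"
      using False by (auto simp: m_def)
    then show ?thesis
      using less.IH[of m] segment_splits_periodic[of m] segment_value_periodic[of m] by simp
  qed
qed

text \<open>Both functions satisfy the same recurrence, which refers only to shorter segments. At
  length 0 there is no split and the mex of the empty set is 0, which covers the junk entry as
  well.\<close>

lemma list_nimber_board_eq: "list_nimber (board d k e) = segment_value d k e"
proof (induction k arbitrary: d e rule: less_induct)
  case (less k)
  have "list_nimber (board d i f) = segment_value d i f \<and> list_nimber (board f j e) = segment_value f j e"
    if "Suc (i + j) = k" for i j f
    using that less.IH by auto
  then have "segment_splits (\<lambda>d k e. list_nimber (board d k e)) d k e = segment_splits segment_value d k e"
    unfolding segment_splits_def by (intro Collect_cong ex_cong1) auto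
  then show ?case
    by (subst list_nimber_board) (simp add: mex_segment_splits)
qed

section \<open>Identifying positions on the path with rows\<close>

text \<open>Entry 0 is the added left edge, so the edge \<open>{j, Suc j}\<close> sits at entry
  \<open>Suc j\<close>, and vertex \<open>w\<close> lies between entries \<open>w\<close> and
  \<open>Suc w\<close>. The two added arrows are left out.\<close>

definition arrows :: "nat \<Rightarrow> bool option list \<Rightarrow> (nat \<times> nat) set" where
  "arrows n zs = {(j, Suc j) | j. j < n \<and> zs ! Suc j = Some True} \<union>
                 {(Suc j, j) | j. j < n \<and> zs ! Suc j = Some False}"

definition path_position :: "nat \<Rightarrow> bool option list \<Rightarrow> bool" where
  "path_position n zs \<longleftrightarrow> length zs = n + 2 \<and> zs ! 0 = Some True \<and> zs ! Suc n = Some False \<and> no_sink zs"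

lemma path_edges_iff:
  "{u, v} \<in> path_edges n \<longleftrightarrow> v = Suc u \<and> u < n \<or> u = Suc v \<and> v < n"
proof -
  have "path_edges n = {{j, Suc j} | j. j < n}"
  proof (intro equalityI subsetI)
    fix e assume "e \<in> path_edges n"
    then obtain j where "e = {j - 1, j}" "1 \<le> j" "j \<le> n"
      by (auto simp: path_edges_def)
    then show "e \<in> {{j, Suc j} | j. j < n}"
      by (intro CollectI exI[of _ "j - 1"]) auto
  next
    fix e assume "e \<in> {{j, Suc j} | j. j < n}"
    then obtain j where "e = {j, Suc j}" "j < n"
      by blast
    then show "e \<in> path_edges n"
      unfolding path_edges_def by (intro CollectI exI[of _ "Suc j"]) auto
  qed
  then show ?thesis
    by (auto simp: doubleton_eq_iff)
qed

lemma arrows_iff: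
  "(u, v) \<in> arrows n zs \<longleftrightarrow>
    v = Suc u \<and> u < n \<and> zs ! Suc u = Some True \<or> u = Suc v \<and> v < n \<and> zs ! Suc v = Some False"
  by (auto simp: arrows_def)

lemma arrows_update:
  assumes "j < n" "length zs = n + 2" "zs ! Suc j = None"
  shows "arrows n (zs[Suc j := Some True]) = insert (j, Suc j) (arrows n zs)"
    and "arrows n (zs[Suc j := Some False]) = insert (Suc j, j) (arrows n zs)"
  using assms by (auto simp: set_eq_iff arrows_iff nth_list_update)

text \<open>At an end vertex the added arrow always points inwards, so the condition on the two
  neighbouring entries reduces to the single real edge; at inner vertices both entries are real
  edges.\<close>

lemma sink_arrows_iff:
  assumes "n \<ge> 1" "zs ! 0 = Some True" "zs ! Suc n = Some False"
  shows "sink (path_edges n) (arrows n zs) w \<longleftrightarrow>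
    w \<le> n \<and> zs ! w = Some True \<and> zs ! Suc w = Some False"
proof -
  have vertices: "w \<in> \<Union>(path_edges n) \<longleftrightarrow> w \<le> n"
  proof
    assume "w \<in> \<Union>(path_edges n)"
    then show "w \<le> n"
      by (auto simp: path_edges_def)
  next
    assume "w \<le> n"
    \<comment> \<open>Vertex 0 has only the edge to its right; every later vertex has one to its
      left.\<close>
    then have "{w - 1, w} \<in> path_edges n \<or> {w, Suc w} \<in> path_edges n"
      using assms(1) unfolding path_edges_iff by (cases w) auto
    then show "w \<in> \<Union>(path_edges n)"
      by blast
  qed
  have "(\<forall>u. {u, w} \<in> path_edges n \<longrightarrow> (u, w) \<in> arrows n zs) \<longleftrightarrow>
      zs ! w = Some True \<and> zs ! Suc w = Some False" if "w \<le> n"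
    using that assms(2,3) by (cases w; cases "w = n") (auto simp: path_edges_iff arrows_iff)
  then show ?thesis
    unfolding sink_def vertices by blast
qed

lemma no_sink_iff_sink:
  assumes "n \<ge> 1" "length zs = n + 2" "zs ! 0 = Some True" "zs ! Suc n = Some False"
  shows "no_sink zs \<longleftrightarrow> \<not> (\<exists>w. sink (path_edges n) (arrows n zs) w)"
  using assms by (auto simp: sink_arrows_iff no_sink_nth)

lemma list_moves_update:
  "i < length zs \<Longrightarrow> zs ! i = None \<Longrightarrow> no_sink (zs[i := Some d]) \<Longrightarrow> zs[i := Some d] \<in> list_moves zs"
  unfolding list_moves_nth by blast

lemma path_position_moves:
  assumes "path_position n zs" "zs' \<in> list_moves zs"
  shows "path_position n zs'"
  using assms by (auto simp: path_position_def list_moves_nth nth_list_update)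

text \<open>The position has no sink, so forbidding new sinks means forbidding sinks altogether,
  which is what \<open>no_sink\<close> says of the padded row.\<close>

lemma cws_moves_arrows:
  assumes "n \<ge> 1" "path_position n zs"
  shows "cws_moves (path_edges n) (arrows n zs) = arrows n ` list_moves zs"
proof -
  have zs: "length zs = n + 2" "zs ! 0 = Some True" "zs ! Suc n = Some False" "no_sink zs"
    using assms(2) by (auto simp: path_position_def)
  have nosink: "\<not> sink (path_edges n) (arrows n zs) w" for w
    using zs assms(1) no_sink_iff_sink by blast
  have legal: "\<not> (\<exists>w. sink (path_edges n) (arrows n (zs[Suc j := Some d])) w) \<longleftrightarrow>
      no_sink (zs[Suc j := Some d])" if "j < n" for j d
    using that zs assms(1) by (subst no_sink_iff_sink[of n]) (auto simp: nth_list_update)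
  show ?thesis
  proof (intro equalityI subsetI)
    fix D assume "D \<in> cws_moves (path_edges n) (arrows n zs)"
    then obtain u v where D: "D = insert (u, v) (arrows n zs)" "{u, v} \<in> path_edges n"
      "\<not> marked (arrows n zs) u v" "\<not> (\<exists>w. sink (path_edges n) D w)"
      unfolding cws_moves_def using nosink by blast
    obtain j d where j: "j < n" "(u, v) = (if d then (j, Suc j) else (Suc j, j))"
    proof -
      consider "v = Suc u" "u < n" | "u = Suc v" "v < n"
        using D(2) path_edges_iff by blast
      then show ?thesis
        using that[of u True] that[of v False] by cases auto
    qed
    have "zs ! Suc j = None"
      using D(3) j by (cases "zs ! Suc j"; cases "the (zs ! Suc j)") (auto simp: marked_def arrows_iff split: if_splits)
    moreover from this have "D = arrows n (zs[Suc j := Some d])"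
      using D(1) j zs(1) arrows_update[of j n zs] by (cases d) auto
    ultimately show "D \<in> arrows n ` list_moves zs"
      using D(4) j(1) legal zs(1) list_moves_update[of "Suc j" zs d] by auto
  next
    fix D assume "D \<in> arrows n ` list_moves zs"
    then obtain i d where i: "D = arrows n (zs[i := Some d])" "i < length zs" "zs ! i = None"
      "no_sink (zs[i := Some d])"
      by (auto simp: list_moves_nth)
    \<comment> \<open>Entries 0 and \<open>Suc n\<close> are already marked, so \<open>i\<close>
      belongs to a real edge.\<close>
    then obtain j where j: "i = Suc j" "j < n"
      using zs by (cases i) (auto simp: less_Suc_eq)
    define u v where "u = (if d then j else Suc j)" and "v = (if d then Suc j else j)"
    have "D = insert (u, v) (arrows n zs)"
      using i(1,3) j zs(1) arrows_update[of j n zs] by (cases d) (auto simp: u_def v_def)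
    moreover have "{u, v} \<in> path_edges n"
      using j(2) unfolding path_edges_iff u_def v_def by simp
    moreover have "\<not> marked (arrows n zs) u v"
      using i(3) j(1) by (auto simp: marked_def arrows_iff u_def v_def)
    moreover have "\<not> (\<exists>w. sink (path_edges n) D w)"
      using legal i(1,4) j by blast
    ultimately show "D \<in> cws_moves (path_edges n) (arrows n zs)"
      unfolding cws_moves_def by blast
  qed
qed

text \<open>The untouched path is the image under \<open>arrows\<close> of the board with two inward
  arrows, so \<open>nimber_image\<close> applies with invariant
  \<open>path_position n\<close>.\<close>

lemma path_nimber_eq_board:
  assumes "n \<ge> 1"
  shows "path_nimber n = nimber list_moves (board True n False)"
proof -
  have nth: "board True n False ! Suc j = None" if "j < n" for j
    using that by (simp add: board_def nth_append)
  then have "arrows n (board True n False) = {}"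
    by (auto simp: arrows_def)
  moreover have "path_position n (board True n False)"
    using assms by (auto simp: path_position_def board_def no_sink_nth nth_append nth_Cons split: nat.splits)
  then have "nimber (cws_moves (path_edges n)) (arrows n (board True n False)) =
      nimber list_moves (board True n False)"
    by (rule nimber_image[where P = "path_position n", rotated -1])
      (auto intro: wf_list_moves wf_cws_moves finite_path_edges path_position_moves
         simp: cws_moves_arrows[OF assms])
  ultimately show ?thesis
    by (simp add: path_nimber_def)
qed

section \<open>The Nimber sequence of the path\<close>

lemma path_nimber_eq: "n \<ge> 1 \<Longrightarrow> path_nimber n = segment_value True n False"
  by (simp add: path_nimber_eq_board list_nimber_board_eq)

theorem theorem3:
  shows "map path_nimber [1..<19] = [0, 1, 0, 1, 0, 3, 2, 0, 2, 3, 0, 1, 0, 1, 0, 5, 7, 0] \<and>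
    (\<forall>n\<ge>19. path_nimber n =
       [1, 0, 1, 0, 3, 2, 4, 5, 3, 0, 1, 0, 1, 0, 5, 7, 8] ! ((n - 19) mod 17))"
proof (intro conjI allI impI)
  have "map path_nimber [1..<19] = map (\<lambda>n. segment_value True n False) [1..<19]"
    by (intro map_cong) (simp_all add: path_nimber_eq)
  also have "\<dots> = [0, 1, 0, 1, 0, 3, 2, 0, 2, 3, 0, 1, 0, 1, 0, 5, 7, 0]"
    by code_simp
  finally show "map path_nimber [1..<19] = [0, 1, 0, 1, 0, 3, 2, 0, 2, 3, 0, 1, 0, 1, 0, 5, 7, 0]" .
next
  let ?c = "[1, 0, 1, 0, 3, 2, 4, 5, 3, 0, 1, 0, 1, 0, 5, 7, 8] :: nat list"
  fix n :: nat assume n: "19 \<le> n"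
  \<comment> \<open>This row is periodic from 19 on already; the range checked includes the full
    tabulated period 27 to 43.\<close>
  have "list_all (\<lambda>n. segment_value True n False = ?c ! ((n - 19) mod 17)) [19..<44]"
    by code_simp
  then have table: "segment_value True n False = ?c ! ((n - 19) mod 17)" if "19 \<le> n" "n < 44" for n
    using that by (simp only: list_all_iff set_upt atLeastLessThan_iff)
  have "segment_value True n False = ?c ! ((n - 19) mod 17)"
  proof (cases "n < 44")
    case False
    define m where "m = 27 + (n - 27) mod 17"
    have m: "19 \<le> m" "m < 44" "27 \<le> m"
      by (simp_all add: m_def)
    have "(m - 19) mod 17 = (n - 19) mod 17"
    proof -
      \<comment> \<open>The stated period starts at 19 and the tabulated one at 27; the common
        offset 8 preserves congruence modulo 17.\<close>
      have "m - 19 = (n - 27) mod 17 + 8" "n - 19 = n - 27 + 8"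
        using False by (simp_all add: m_def)
      then show ?thesis
        by (simp only: mod_add_left_eq)
    qed
    moreover have "segment_value True n False = segment_value True m False"
      using False m(3) by (simp add: segment_value_def m_def)
    ultimately show ?thesis
      using table[OF m(1,2)] by simp
  qed (use n table in blast)
  then show "path_nimber n = ?c ! ((n - 19) mod 17)"
    using n by (simp add: path_nimber_eq)
qed

end
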